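(* Let $l_k$, $m_k$ ($k=1,\dots,K$) and $n$ be the constants given in the context. Consider the optimization problem $$\min_{\mu_1,\dots,\mu_K,\rho}\ -\sum_{k=1}^K\ln\left(1+\frac{l_k\mu_k}{\rho+n}\right)\quad\text{s.t.}\quad\sum_{k=1}^K\mu_k\le1,\quad\sum_{i=1}^Km_i\mu_i\le\rho,\quad\mu_k\ge0,\ k=1,\dots,K.$$ The optimal solution is given as $$\mu_k=\max\left\{\frac{1}{v+wm_k}-\frac{\rho+n}{l_k},\,0\right\},$$ where $v$ and $w$ are chosen by satisfying $\sum_{k=1}^K\mu_k=1$ and $\sum_{i=1}^Km_i\mu_i=\rho$, respectively.
   Context: The constants are $l_k=\pi\eta N_dP_rP_T\xi_k$, $m_i=4\sigma_d^2P_T\xi_i$, $n=\sigma_r^2\eta P_r(\pi\delta+4)+4\sigma_d^2\sigma_r^2$, where $\eta,\xi_1,\dots,\xi_K,P_r,P_T,N_d,\delta,\sigma_r^2,\sigma_d^2$ are fixed positive parameters (path losses, relay power, total user power, number of base-station antennas, ratio of base-station to relay antennas, noise variances). The variable $\mu_k$ is the fraction of the total user power $P_T$ given to user $k$ among $K$ users, and $\rho$ is an auxiliary real variable. *)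

theory Defs
  imports "HOL-Analysis.Analysis"
begin

definition power_objective :: "real^'k \<Rightarrow> real \<Rightarrow> (real^'k) \<times> real \<Rightarrow> real" where
  "power_objective l n = (\<lambda>(\<mu>, \<rho>). - (\<Sum>k\<in>UNIV. ln (1 + l $ k * \<mu> $ k / (\<rho> + n))))"

definition power_feasible :: "real^'k \<Rightarrow> (real^'k) \<times> real \<Rightarrow> bool" where
  "power_feasible m = (\<lambda>(\<mu>, \<rho>).
     (\<Sum>k\<in>UNIV. \<mu> $ k) \<le> 1 \<and> (\<Sum>i\<in>UNIV. m $ i * \<mu> $ i) \<le> \<rho> \<and> (\<forall>k. 0 \<le> \<mu> $ k))"

definition power_optimal :: "real^'k \<Rightarrow> real^'k \<Rightarrow> real \<Rightarrow> real^'k \<Rightarrow> real \<Rightarrow> bool" where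
  "power_optimal l m n \<mu> \<rho> \<longleftrightarrow> is_arg_min (power_objective l n) (power_feasible m) (\<mu>, \<rho>)"

(* The condition 0 < v + w * m $ k keeps 1 / (v + w * m $ k) a genuine quotient; without it
   the convention 1 / 0 = 0 or a negative denominator would silently give \<mu> $ k = 0. *)
definition waterfilling ::
  "real^'k \<Rightarrow> real^'k \<Rightarrow> real \<Rightarrow> real \<Rightarrow> real \<Rightarrow> real^'k \<Rightarrow> real \<Rightarrow> bool" where
  "waterfilling l m n v w \<mu> \<rho> \<longleftrightarrow>
     (\<forall>k. 0 < v + w * m $ k) \<and>
     (\<forall>k. \<mu> $ k = max (1 / (v + w * m $ k) - (\<rho> + n) / l $ k) 0) \<and>
     (\<Sum>k\<in>UNIV. \<mu> $ k) = 1 \<and>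
     (\<Sum>i\<in>UNIV. m $ i * \<mu> $ i) = \<rho>"

end

theory Submission
  imports Defs
begin

text \<open>
  The variables \<open>u\<^sub>k = l\<^sub>k \<mu>\<^sub>k / (\<rho> + n)\<close> turn the objective into the concave sum
  \<open>\<Sum>\<^sub>k ln (1 + u\<^sub>k)\<close>, and adding \<open>n\<close> times the first constraint to the second gives the linear constraint
  \<open>\<Sum>\<^sub>k (n / l\<^sub>k + m\<^sub>k / l\<^sub>k) u\<^sub>k \<le> 1\<close>. Since \<open>m\<^sub>k / l\<^sub>k\<close> does not depend on \<open>k\<close>, the maximum
  of the relaxed problem is attained by classical water-filling and comes from a feasible point of the
  original problem at which both constraints are tight. Its multipliers are proportional:
  \<open>v = n w\<close>. For other multipliers \<open>v\<close>, \<open>w\<close>, of any sign, a water-filling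
  point at the optimal \<open>\<rho>\<close> satisfies the KKT conditions of the problem with both constraints
  imposed as equalities, which is enough for optimality.
\<close>

section \<open>Water-filling for a sum of logarithms\<close>

text \<open>By strict concavity the graph lies strictly below its tangent at \<open>y\<close>, whose
  slope is \<open>1 / (1 + y)\<close>. This slope equals \<open>g\<close> if \<open>y > 0\<close>;
  if \<open>y = 0\<close> it is at most \<open>g\<close>, and \<open>z - y\<close> is
  nonnegative.\<close>

lemma ln_one_plus_waterfill_less:
  fixes g y z :: real
  assumes "0 < g" "y = max (1 / g - 1) 0" "0 \<le> z" "z \<noteq> y"
  shows "ln (1 + z) - ln (1 + y) < g * (z - y)"
proof -
  have y: "0 \<le> y" using assms by simp
  have pos: "0 < (1 + z) / (1 + y)" using y assms by simp
  have "ln (1 + z) - ln (1 + y) = ln ((1 + z) / (1 + y))"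
    using y assms by (simp add: ln_div)
  also have "\<dots> < (1 + z) / (1 + y) - 1"
  proof -
    have "(1 + z) / (1 + y) \<noteq> 1" using y assms by (simp add: field_simps)
    then show ?thesis
      using ln_le_minus_one[OF pos] ln_eq_minus_one[OF pos] by fastforce
  qed
  also have "\<dots> = (z - y) / (1 + y)" using y by (simp add: field_simps)
  also have "\<dots> \<le> g * (z - y)"
  proof (cases "y = 0")
    case True
    then have "1 / g \<le> 1" using assms(2) by simp
    then have "1 \<le> g" using assms(1) by (simp add: field_simps)
    then have "1 * z \<le> g * z" using assms(3) by (rule mult_right_mono)
    then show ?thesis using True by simp
  next
    case False
    then have "1 + y = 1 / g" using assms(2) by (auto simp: max_def split: if_splits)
    then show ?thesis by (simp add: mult.commute)
  qed
  finally show ?thesis .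
qed

text \<open>The numbers \<open>g k\<close> act as prices: summing the tangent bounds leaves the
  difference of the two costs, which \<open>le\<close> makes nonpositive. One differing index
  suffices for strictness.\<close>

lemma sum_ln_waterfill_less:
  fixes g y z :: "'a \<Rightarrow> real"
  assumes "finite A"
    and g: "\<And>k. k \<in> A \<Longrightarrow> 0 < g k"
    and y: "\<And>k. k \<in> A \<Longrightarrow> y k = max (1 / g k - 1) 0"
    and z: "\<And>k. k \<in> A \<Longrightarrow> 0 \<le> z k"
    and le: "(\<Sum>k\<in>A. g k * z k) \<le> (\<Sum>k\<in>A. g k * y k)"
    and ne: "\<exists>k\<in>A. z k \<noteq> y k"
  shows "(\<Sum>k\<in>A. ln (1 + z k)) < (\<Sum>k\<in>A. ln (1 + y k))"
proof -
  have lt: "ln (1 + z k) - ln (1 + y k) < g k * (z k - y k)" if "k \<in> A" "z k \<noteq> y k" for k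
    using ln_one_plus_waterfill_less[OF g y z] that by blast
  have "(\<Sum>k\<in>A. ln (1 + z k) - ln (1 + y k)) < (\<Sum>k\<in>A. g k * (z k - y k))"
  proof (rule sum_strict_mono_ex1[OF \<open>finite A\<close>])
    show "\<forall>k\<in>A. ln (1 + z k) - ln (1 + y k) \<le> g k * (z k - y k)"
    proof
      fix k assume "k \<in> A"
      then show "ln (1 + z k) - ln (1 + y k) \<le> g k * (z k - y k)"
        using lt[of k] by (cases "z k = y k") (auto intro: less_imp_le)
    qed
    show "\<exists>k\<in>A. ln (1 + z k) - ln (1 + y k) < g k * (z k - y k)"
      using ne lt by blast
  qed
  then show ?thesis
    using le by (simp add: sum_subtractf right_diff_distrib)
qed

text \<open>Intermediate value theorem: level 0 lies below every bottom \<open>a k\<close>, so no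
  water is held there, while at level \<open>a j + 1\<close> column \<open>j\<close> alone already
  holds volume 1.\<close>

lemma water_level_exists:
  fixes a :: "'a \<Rightarrow> real"
  assumes "finite A" "A \<noteq> {}" "\<And>k. k \<in> A \<Longrightarrow> 0 < a k"
  obtains t where "0 < t" "(\<Sum>k\<in>A. max (t - a k) 0) = 1"
proof -
  let ?h = "\<lambda>t. \<Sum>k\<in>A. max (t - a k) 0"
  obtain j where j: "j \<in> A" using assms by blast
  have h0: "?h 0 = 0"
    using assms(3) by (intro sum.neutral) (auto simp: less_imp_le)
  have "max ((a j + 1) - a j) 0 \<le> ?h (a j + 1)"
    using assms(1) j by (intro member_le_sum) auto
  then have h1: "1 \<le> ?h (a j + 1)" by simp
  have "\<exists>t\<ge>0. t \<le> a j + 1 \<and> ?h t = 1"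
    using h0 h1 assms(3)[OF j] by (intro IVT') (auto intro!: continuous_intros)
  then obtain t where t: "0 \<le> t" "?h t = 1" by blast
  with h0 have "t \<noteq> 0" by auto
  with t show ?thesis by (intro that[of t]) auto
qed

section \<open>Comparing objective values in the rescaled variables\<close>

text \<open>After rescaling, \<open>le\<close> is the cost comparison of
  \<open>sum_ln_waterfill_less\<close>, multiplied by \<open>\<rho>' + n\<close>. The multipliers
  may have any sign, since only \<open>v + w * m $ k\<close> has to be positive. The points must
  differ in the rescaled variables, because the objective sees nothing else.\<close>

lemma waterfilling_objective_less:
  fixes l m \<mu> \<mu>' :: "real^'k"
  assumes l: "\<And>k. 0 < l $ k"
    and wf: "waterfilling l m n v w \<mu> \<rho>"
    and pos: "0 < \<rho> + n" "0 < \<rho>' + n"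
    and nonneg: "\<And>k. 0 \<le> \<mu>' $ k"
    and le: "(\<rho> + n) * (v * (\<Sum>k\<in>UNIV. \<mu>' $ k) + w * (\<Sum>k\<in>UNIV. m $ k * \<mu>' $ k))
      \<le> (\<rho>' + n) * (v + w * \<rho>)"
    and ne: "\<exists>k. l $ k * \<mu>' $ k / (\<rho>' + n) \<noteq> l $ k * \<mu> $ k / (\<rho> + n)"
  shows "power_objective l n (\<mu>, \<rho>) < power_objective l n (\<mu>', \<rho>')"
proof -
  \<comment> \<open>The multiplier \<open>v + w * m $ k\<close> is the price of
    \<open>\<mu> $ k\<close>; the factor \<open>(\<rho> + n) / l $ k\<close> converts it to a price
    per unit of \<open>y k\<close>.\<close>
  define g where "g k = (\<rho> + n) * (v + w * m $ k) / l $ k" for k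
  define y where "y k = l $ k * \<mu> $ k / (\<rho> + n)" for k
  define z where "z k = l $ k * \<mu>' $ k / (\<rho>' + n)" for k
  have den: "0 < v + w * m $ k" for k
    using wf by (simp add: waterfilling_def)
  have \<mu>: "\<mu> $ k = max (1 / (v + w * m $ k) - (\<rho> + n) / l $ k) 0" for k
    using wf by (simp add: waterfilling_def)
  have sums: "(\<Sum>k\<in>UNIV. \<mu> $ k) = 1" "(\<Sum>k\<in>UNIV. m $ k * \<mu> $ k) = \<rho>"
    using wf unfolding waterfilling_def by blast+
  have g_pos: "0 < g k" for k
    using den pos(1) l by (simp add: g_def)
  have y_eq: "y k = max (1 / g k - 1) 0" for k
  proof -
    have "y k = (l $ k / (\<rho> + n)) * \<mu> $ k" by (simp add: y_def)
    also have "\<dots> = max ((l $ k / (\<rho> + n)) * (1 / (v + w * m $ k) - (\<rho> + n) / l $ k)) 0"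
      unfolding \<mu> using l[of k] pos(1) by (subst max_mult_distrib_left) auto
    also have "(l $ k / (\<rho> + n)) * (1 / (v + w * m $ k) - (\<rho> + n) / l $ k) = 1 / g k - 1"
      using l[of k] pos(1) den[of k] by (simp add: g_def right_diff_distrib)
    finally show ?thesis .
  qed
  have gy: "g k * y k = v * \<mu> $ k + w * (m $ k * \<mu> $ k)" for k
  proof -
    have "g k * y k = (v + w * m $ k) * \<mu> $ k"
      using l[of k] pos(1) by (simp add: g_def y_def)
    then show ?thesis by (simp add: algebra_simps)
  qed
  have gz: "g k * z k
      = (\<rho> + n) / (\<rho>' + n) * (v * \<mu>' $ k + w * (m $ k * \<mu>' $ k))" for k
  proof -
    have "g k * z k = (\<rho> + n) / (\<rho>' + n) * ((v + w * m $ k) * \<mu>' $ k)"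
      using l[of k] pos(2) by (simp add: g_def z_def)
    then show ?thesis by (simp add: distrib_right mult.assoc)
  qed
  have "(\<Sum>k\<in>UNIV. g k * y k) = v + w * \<rho>"
    by (simp add: gy sum.distrib sums flip: sum_distrib_left)
  moreover have "(\<Sum>k\<in>UNIV. g k * z k) = (\<rho> + n) / (\<rho>' + n)
      * (v * (\<Sum>k\<in>UNIV. \<mu>' $ k) + w * (\<Sum>k\<in>UNIV. m $ k * \<mu>' $ k))"
    unfolding gz by (simp only: sum.distrib flip: sum_distrib_left)
  ultimately have "(\<Sum>k\<in>UNIV. g k * z k) \<le> (\<Sum>k\<in>UNIV. g k * y k)"
    using le pos(2) by (simp add: pos_divide_le_eq mult.commute)
  moreover have "0 \<le> z k" for k
    using nonneg[of k] l[of k] pos(2) by (simp add: z_def)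
  ultimately have "(\<Sum>k\<in>UNIV. ln (1 + z k)) < (\<Sum>k\<in>UNIV. ln (1 + y k))"
    using ne[folded y_def z_def] g_pos y_eq by (intro sum_ln_waterfill_less[where g = g] finite) blast+
  then show ?thesis
    by (simp add: power_objective_def y_def z_def)
qed

lemma waterfilling_feasible:
  assumes "waterfilling l m n v w \<mu> \<rho>"
  shows "power_feasible m (\<mu>, \<rho>)"
proof -
  have "0 \<le> \<mu> $ k" for k
    using assms by (simp add: waterfilling_def)
  moreover have "(\<Sum>k\<in>UNIV. \<mu> $ k) = 1" "(\<Sum>k\<in>UNIV. m $ k * \<mu> $ k) = \<rho>"
    using assms unfolding waterfilling_def by blast+
  ultimately show ?thesis by (simp add: power_feasible_def)
qed

lemma power_feasible_nonneg:
  assumes "\<And>k. 0 \<le> m $ k" "power_feasible m (\<mu>, \<rho>)"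
  shows "0 \<le> \<rho>"
proof -
  have "0 \<le> (\<Sum>i\<in>UNIV. m $ i * \<mu> $ i)"
    using assms by (intro sum_nonneg) (simp add: power_feasible_def)
  then show ?thesis using assms(2) by (simp add: power_feasible_def)
qed

text \<open>With \<open>v = n * w\<close> the price of any feasible competitor is \<open>w\<close>
  times \<open>n\<close> times the first constraint plus the second, hence at most
  \<open>w * (\<rho>' + n)\<close>. The price of the water-filling point is exactly
  \<open>w * (\<rho> + n)\<close>, so the cost comparison holds even when \<open>\<rho>'\<close>
  differs from \<open>\<rho>\<close>.\<close>

lemma proportional_waterfilling_strict_optimum:
  fixes l m \<mu> \<mu>' :: "real^'k"
  assumes l: "\<And>k. 0 < l $ k" and m: "\<And>k. 0 \<le> m $ k" and n: "0 < n" and w: "0 \<le> w"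
    and wf: "waterfilling l m n (n * w) w \<mu> \<rho>"
    and feas: "power_feasible m (\<mu>', \<rho>')"
    and ne: "(\<mu>', \<rho>') \<noteq> (\<mu>, \<rho>)"
  shows "power_objective l n (\<mu>, \<rho>) < power_objective l n (\<mu>', \<rho>')"
proof (rule waterfilling_objective_less[OF l wf])
  have sums: "(\<Sum>k\<in>UNIV. \<mu> $ k) = 1" "(\<Sum>k\<in>UNIV. m $ k * \<mu> $ k) = \<rho>"
    using wf unfolding waterfilling_def by blast+
  have sums': "(\<Sum>k\<in>UNIV. \<mu>' $ k) \<le> 1" "(\<Sum>k\<in>UNIV. m $ k * \<mu>' $ k) \<le> \<rho>'"
    using feas by (simp_all add: power_feasible_def)
  show pos: "0 < \<rho> + n" and pos': "0 < \<rho>' + n"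
    using power_feasible_nonneg[OF m] waterfilling_feasible[OF wf] feas n
    by (auto intro: add_nonneg_pos)
  show "0 \<le> \<mu>' $ k" for k
    using feas by (simp add: power_feasible_def)
  have "n * (\<Sum>k\<in>UNIV. \<mu>' $ k) \<le> n"
    using sums'(1) n by simp
  then have "n * (\<Sum>k\<in>UNIV. \<mu>' $ k) + (\<Sum>k\<in>UNIV. m $ k * \<mu>' $ k) \<le> \<rho>' + n"
    using sums'(2) by linarith
  then have "((\<rho> + n) * w) * (n * (\<Sum>k\<in>UNIV. \<mu>' $ k) + (\<Sum>k\<in>UNIV. m $ k * \<mu>' $ k))
      \<le> ((\<rho> + n) * w) * (\<rho>' + n)"
    using pos w by (intro mult_left_mono) auto
  then show "(\<rho> + n) * (n * w * (\<Sum>k\<in>UNIV. \<mu>' $ k) + w * (\<Sum>k\<in>UNIV. m $ k * \<mu>' $ k))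
      \<le> (\<rho>' + n) * (n * w + w * \<rho>)"
    by (simp add: algebra_simps)
  \<comment> \<open>Points with the same rescaled variables have the same objective value, so here
    the constraints must separate them. Such points are proportional with factor \<open>q\<close>;
    the first constraint then gives \<open>\<rho>' \<le> \<rho>\<close> and the second the
    converse.\<close>
  show "\<exists>k. l $ k * \<mu>' $ k / (\<rho>' + n) \<noteq> l $ k * \<mu> $ k / (\<rho> + n)"
  proof (rule ccontr)
    assume "\<not> ?thesis"
    then have eq: "l $ k * \<mu>' $ k / (\<rho>' + n) = l $ k * \<mu> $ k / (\<rho> + n)" for k
      by blast
    define q where "q = (\<rho>' + n) / (\<rho> + n)"
    have \<mu>': "\<mu>' $ k = q * \<mu> $ k" for k
    proof -
      have "l $ k * (\<mu>' $ k / (\<rho>' + n)) = l $ k * (\<mu> $ k / (\<rho> + n))"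
        using eq[of k] by simp
      then have "\<mu>' $ k / (\<rho>' + n) = \<mu> $ k / (\<rho> + n)"
        using l[of k] by (simp del: times_divide_eq_right)
      then show ?thesis using pos pos' by (simp add: q_def field_simps)
    qed
    have "(\<Sum>k\<in>UNIV. \<mu>' $ k) = q"
      by (simp add: \<mu>' sums flip: sum_distrib_left)
    then have "\<rho>' \<le> \<rho>"
      using sums'(1) pos by (simp add: q_def)
    have "(\<Sum>k\<in>UNIV. m $ k * \<mu>' $ k) = q * \<rho>"
      by (simp add: \<mu>' mult.left_commute sums flip: sum_distrib_left)
    then have "(\<rho>' + n) * \<rho> \<le> \<rho>' * (\<rho> + n)"
      using sums'(2) pos by (simp add: q_def pos_divide_le_eq)
    then have "\<rho> \<le> \<rho>'"
      using n by (simp add: algebra_simps)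
    with \<open>\<rho>' \<le> \<rho>\<close> have "\<rho>' = \<rho>" by simp
    then have "q = 1" using pos by (simp add: q_def)
    then have "\<mu>' = \<mu>" by (simp add: vec_eq_iff \<mu>')
    with \<open>\<rho>' = \<rho>\<close> ne show False by simp
  qed
qed

section \<open>Constructing a water-filling point with proportional multipliers\<close>

text \<open>Because \<open>m\<close> is proportional to \<open>l\<close>, the weights
  \<open>a k\<close> of the relaxed constraint do not involve \<open>\<rho>\<close>. Classical
  water-filling therefore fixes the rescaled variables \<open>y k\<close> first, and
  \<open>\<rho>\<close> is recovered afterwards from the total power.\<close>

lemma proportional_waterfilling_exists:
  fixes l m :: "real^'k"
  assumes l: "\<And>k. 0 < l $ k" and m: "\<And>k. m $ k = c * l $ k" and c: "0 \<le> c" and n: "0 < n"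
  obtains w \<mu> \<rho> where "0 < w" "waterfilling l m n (n * w) w \<mu> \<rho>"
proof -
  define a where "a k = n / l $ k + c" for k
  have a: "0 < a k" for k
    using l n c by (simp add: a_def add_pos_nonneg)
  obtain t where t: "0 < t" "(\<Sum>k\<in>UNIV. max (t - a k) 0) = 1"
    using water_level_exists[of UNIV a] a by auto
  \<comment> \<open>The relaxed optimum: \<open>a k * y k\<close> is the depth of water over the
    bottom \<open>a k\<close>, so the weighted total of the \<open>y k\<close> is 1.\<close>
  define y where "y k = max (t / a k - 1) 0" for k
  have ay: "a k * y k = max (t - a k) 0" for k
    using a[of k] by (simp add: y_def max_mult_distrib_left right_diff_distrib)
  \<comment> \<open>Undoing the rescaling gives
    \<open>\<mu> $ k = (\<rho> + n) * y k / l $ k\<close>, so total power 1 forces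
    \<open>\<rho> + n = 1 / s\<close>.\<close>
  define s where "s = (\<Sum>k\<in>UNIV. y k / l $ k)"
  have total: "n * s + c * (\<Sum>k\<in>UNIV. y k) = 1"
  proof -
    have "n * s + c * (\<Sum>k\<in>UNIV. y k) = (\<Sum>k\<in>UNIV. a k * y k)"
      by (simp add: s_def a_def sum_distrib_left distrib_right sum.distrib)
    also have "\<dots> = 1" using t by (simp add: ay)
    finally show ?thesis .
  qed
  have "0 < s"
  proof -
    have "\<exists>k. 0 < y k"
    proof (rule ccontr)
      assume "\<not> ?thesis"
      then have "y k = 0" for k
        by (metis y_def max.cobounded2 order_less_le)
      then show False using total by (simp add: s_def)
    qed
    then obtain k where "0 < y k" ..
    then show ?thesis
      unfolding s_def using l by (intro sum_pos2[of _ k]) (auto simp: y_def less_imp_le)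
  qed
  \<comment> \<open>Chosen so that the price
    \<open>(\<rho> + n) * (n * w + w * m $ k) / l $ k\<close>, which is \<open>w * a k / s\<close>,
    equals \<open>a k / t\<close>.\<close>
  define w where "w = s / t"
  define \<mu> :: "real^'k" where "\<mu> = (\<chi> k. y k / (s * l $ k))"
  define \<rho> where "\<rho> = (\<Sum>k\<in>UNIV. m $ k * \<mu> $ k)"
  have "0 < w" using \<open>0 < s\<close> t by (simp add: w_def)
  have "\<rho> = c * (\<Sum>k\<in>UNIV. y k) / s"
    unfolding \<rho>_def \<mu>_def sum_distrib_left sum_divide_distrib
    by (intro sum.cong refl) (use l in \<open>simp add: m less_imp_neq[symmetric]\<close>)
  \<comment> \<open>Dividing \<open>total\<close> by \<open>s\<close> shows that the
    \<open>\<rho>\<close> defined by the tight second constraint agrees with the value forced by the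
    first.\<close>
  then have q: "\<rho> + n = 1 / s"
    using total \<open>0 < s\<close> by (simp add: field_simps)
  have den: "n * w + w * m $ k = w * (l $ k * a k)" for k
    using l[of k] by (simp add: a_def m algebra_simps)
  have "waterfilling l m n (n * w) w \<mu> \<rho>"
    unfolding waterfilling_def
  proof (intro conjI allI)
    fix k
    show "0 < n * w + w * m $ k"
      unfolding den using \<open>0 < w\<close> l a by simp
    have "\<mu> $ k = 1 / (s * l $ k) * y k"
      by (simp add: \<mu>_def)
    also have "\<dots> = max (1 / (s * l $ k) * (t / a k - 1)) 0"
      unfolding y_def using l[of k] \<open>0 < s\<close> by (subst max_mult_distrib_left) auto
    also have "1 / (s * l $ k) * (t / a k - 1) = 1 / (n * w + w * m $ k) - (\<rho> + n) / l $ k"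
      unfolding den unfolding q w_def using l[of k] \<open>0 < s\<close> t a[of k] by (simp add: field_simps)
    finally show "\<mu> $ k = max (1 / (n * w + w * m $ k) - (\<rho> + n) / l $ k) 0" .
  next
    have "(\<Sum>k\<in>UNIV. \<mu> $ k) = (\<Sum>k\<in>UNIV. y k / l $ k) / s"
      unfolding sum_divide_distrib by (simp add: \<mu>_def mult.commute)
    then show "(\<Sum>k\<in>UNIV. \<mu> $ k) = 1"
      using \<open>0 < s\<close> by (simp add: s_def)
  qed (simp add: \<rho>_def)
  with \<open>0 < w\<close> show ?thesis by (rule that)
qed

section \<open>The problem with the given constants\<close>

theorem theorem4:
  fixes \<eta> P\<^sub>r P\<^sub>T \<delta> \<sigma>\<^sub>r \<sigma>\<^sub>d n :: real
    and N\<^sub>d :: nat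
    and \<xi> l m :: "real^'k"
  assumes "0 < \<eta>" "0 < P\<^sub>r" "0 < P\<^sub>T" "0 < N\<^sub>d" "0 < \<delta>" "0 < \<sigma>\<^sub>r\<^sup>2" "0 < \<sigma>\<^sub>d\<^sup>2"
    and "\<forall>k. 0 < \<xi> $ k"
    and "\<forall>k. l $ k = pi * \<eta> * real N\<^sub>d * P\<^sub>r * P\<^sub>T * \<xi> $ k"
    and "\<forall>i. m $ i = 4 * \<sigma>\<^sub>d\<^sup>2 * P\<^sub>T * \<xi> $ i"
    and "n = \<sigma>\<^sub>r\<^sup>2 * \<eta> * P\<^sub>r * (pi * \<delta> + 4) + 4 * \<sigma>\<^sub>d\<^sup>2 * \<sigma>\<^sub>r\<^sup>2"
  shows "(\<exists>!(\<mu>, \<rho>). power_optimal l m n \<mu> \<rho>) \<and>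
    (\<forall>\<mu> \<rho>. power_optimal l m n \<mu> \<rho> \<longrightarrow>
      (\<exists>v w. 0 \<le> v \<and> 0 \<le> w \<and> waterfilling l m n v w \<mu> \<rho>)) \<and>
    (\<forall>\<mu> \<rho> v w. (\<exists>\<mu>'. power_optimal l m n \<mu>' \<rho>) \<and> waterfilling l m n v w \<mu> \<rho> \<longrightarrow>
      power_optimal l m n \<mu> \<rho>)"
proof -
  \<comment> \<open>The common ratio of \<open>m $ k\<close> to \<open>l $ k\<close>, in which
    \<open>P\<^sub>T\<close> and \<open>\<xi> $ k\<close> cancel.\<close>
  define c where "c = 4 * \<sigma>\<^sub>d\<^sup>2 / (pi * \<eta> * real N\<^sub>d * P\<^sub>r)"
  have l: "0 < l $ k" for k using assms by simp
  have c: "0 \<le> c" using assms by (simp add: c_def)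
  have m: "m $ k = c * l $ k" for k using assms by (simp add: c_def)
  then have m_nonneg: "0 \<le> m $ k" for k using c l[of k] by simp
  have n: "0 < n" using assms by (simp add: add_pos_pos)
  obtain w\<^sub>0 \<mu>\<^sub>0 \<rho>\<^sub>0 where w\<^sub>0: "0 < w\<^sub>0" and wf: "waterfilling l m n (n * w\<^sub>0) w\<^sub>0 \<mu>\<^sub>0 \<rho>\<^sub>0"
    using proportional_waterfilling_exists[OF l m c n] .
  have less: "power_objective l n (\<mu>\<^sub>0, \<rho>\<^sub>0) < power_objective l n (\<mu>, \<rho>)"
    if "power_feasible m (\<mu>, \<rho>)" "(\<mu>, \<rho>) \<noteq> (\<mu>\<^sub>0, \<rho>\<^sub>0)" for \<mu> \<rho>
    using proportional_waterfilling_strict_optimum[OF l m_nonneg n _ wf that] w\<^sub>0 by simp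
  have opt: "power_optimal l m n \<mu> \<rho> \<longleftrightarrow> (\<mu>, \<rho>) = (\<mu>\<^sub>0, \<rho>\<^sub>0)" for \<mu> \<rho>
    using less waterfilling_feasible[OF wf]
    unfolding power_optimal_def is_arg_min_def by (metis order_less_asym surj_pair)
  \<comment> \<open>At the same \<open>\<rho>\<^sub>0\<close> both points satisfy both constraints
    with equality, so their costs agree for every choice of \<open>v\<close> and \<open>w\<close>. A
    different water-filling point would thus strictly beat \<open>\<mu>\<^sub>0\<close>,
    contradicting \<open>less\<close>.\<close>
  have unique: "\<mu> = \<mu>\<^sub>0" if wf': "waterfilling l m n v w \<mu> \<rho>\<^sub>0" for \<mu> v w
  proof (rule ccontr)
    assume "\<mu> \<noteq> \<mu>\<^sub>0"
    then obtain k where k: "\<mu> $ k \<noteq> \<mu>\<^sub>0 $ k" by (auto simp: vec_eq_iff)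
    have pos: "0 < \<rho>\<^sub>0 + n"
      using power_feasible_nonneg[OF m_nonneg waterfilling_feasible[OF wf]] n by simp
    have "power_objective l n (\<mu>, \<rho>\<^sub>0) < power_objective l n (\<mu>\<^sub>0, \<rho>\<^sub>0)"
    proof (rule waterfilling_objective_less[OF l wf' pos pos])
      show "0 \<le> \<mu>\<^sub>0 $ k" for k using wf by (simp add: waterfilling_def)
      show "\<exists>k. l $ k * \<mu>\<^sub>0 $ k / (\<rho>\<^sub>0 + n) \<noteq> l $ k * \<mu> $ k / (\<rho>\<^sub>0 + n)"
        using k l[of k] pos by (intro exI[of _ k]) simp
      have "(\<Sum>k\<in>UNIV. \<mu>\<^sub>0 $ k) = 1" "(\<Sum>k\<in>UNIV. m $ k * \<mu>\<^sub>0 $ k) = \<rho>\<^sub>0"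
        using wf unfolding waterfilling_def by blast+
      then show "(\<rho>\<^sub>0 + n) * (v * (\<Sum>k\<in>UNIV. \<mu>\<^sub>0 $ k) + w * (\<Sum>k\<in>UNIV. m $ k * \<mu>\<^sub>0 $ k))
          \<le> (\<rho>\<^sub>0 + n) * (v + w * \<rho>\<^sub>0)" by simp
    qed
    with less[OF waterfilling_feasible[OF wf']] \<open>\<mu> \<noteq> \<mu>\<^sub>0\<close> show False by fastforce
  qed
  show ?thesis
  proof (intro conjI allI impI)
    show "\<exists>!(\<mu>, \<rho>). power_optimal l m n \<mu> \<rho>" by (auto simp: opt)
  next
    fix \<mu> \<rho> assume "power_optimal l m n \<mu> \<rho>"
    then have "waterfilling l m n (n * w\<^sub>0) w\<^sub>0 \<mu> \<rho>" using wf by (simp add: opt)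
    moreover have "0 \<le> n * w\<^sub>0" "0 \<le> w\<^sub>0" using n w\<^sub>0 by simp_all
    ultimately show "\<exists>v w. 0 \<le> v \<and> 0 \<le> w \<and> waterfilling l m n v w \<mu> \<rho>" by blast
  next
    fix \<mu> \<rho> v w
    assume "(\<exists>\<mu>'. power_optimal l m n \<mu>' \<rho>) \<and> waterfilling l m n v w \<mu> \<rho>"
    then show "power_optimal l m n \<mu> \<rho>" using unique by (auto simp: opt)
  qed
qed

end
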